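(* For every integer $n\ge 0$, $$c(27n+24)\equiv 0\pmod 9.$$
   Context: For a positive integer $k$, $(q^k;q^k)_\infty:=\prod_{m\ge 1}(1-q^{km})$, viewed as a formal power series in $q$ with integer coefficients. The integers $c(n)$ ($n\ge 0$) are defined by the generating function $$\sum_{n=0}^\infty c(n)q^n=\frac{q\,(q^6;q^6)_\infty^3}{(q;q)_\infty(q^2;q^2)_\infty}.$$ *)

theory Defs
  imports "HOL-Analysis.Infinite_Products"
    "HOL-Computational_Algebra.Formal_Power_Series"
    "HOL-Number_Theory.Cong"
begin

text \<open>
  The infinite product is the limit of its partial products in the usual topology on formal
  power series. The factors are indexed from 0, hence the \<open>Suc m\<close>.
\<close>

definition qprod :: "nat \<Rightarrow> int fps" where
  "qprod k = prodinf (\<lambda>m. 1 - fps_X ^ (k * Suc m))"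

text \<open>
  Since \<open>int\<close> is not a field, \<open>inverse\<close> is not available on \<open>int fps\<close>; the reciprocal of a series
  with constant coefficient 1 is \<open>fps_right_inverse _ 1\<close>.
\<close>

definition c_gf :: "int fps" where
  "c_gf = fps_X * qprod 6 ^ 3 * fps_right_inverse (qprod 1 * qprod 2) 1"

definition c :: "nat \<Rightarrow> int" where
  "c n = fps_nth c_gf n"

text \<open>
  For positive \<open>k\<close> the product converges and has constant coefficient 1, so that \<open>qprod\<close> and the
  quotient \<open>c_gf\<close> are meaningful.
\<close>

lemma has_prod_qprod:
  assumes "k > 0"
  shows "(\<lambda>m. 1 - fps_X ^ (k * Suc m)) has_prod qprod k"
    and "fps_nth (qprod k) 0 = 1"
proof -
  define P :: "nat \<Rightarrow> int fps" where "P n = (\<Prod>m\<le>n. 1 - fps_X ^ (k * Suc m))" for n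
  define L where "L = Abs_fps (\<lambda>j. fps_nth (P j) j)"
  have step: "fps_nth (P (Suc n)) j = fps_nth (P n) j" if "j \<le> n" for n j
  proof -
    have "Suc (Suc n) \<le> k * Suc (Suc n)"
      using mult_le_mono1[of 1 k "Suc (Suc n)"] assms by simp
    hence "j < k * Suc (Suc n)"
      using that by (simp only: less_le_trans[of j "Suc (Suc n)"] le_imp_less_Suc le_SucI)
    moreover have "P (Suc n) = P n * (1 - fps_X ^ (k * Suc (Suc n)))"
      unfolding P_def by (rule prod.atMost_Suc)
    hence "P (Suc n) = P n - P n * fps_X ^ (k * Suc (Suc n))"
      by (simp only: right_diff_distrib mult_1_right)
    ultimately show ?thesis
      by (simp only: fps_sub_nth fps_X_power_mult_right_nth if_True diff_zero)
  qed
  have stable: "fps_nth (P n) j = fps_nth (P j) j" if "j \<le> n" for n j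
    using that by (induction n rule: dec_induct) (auto simp: step)
  have "P \<longlonglongrightarrow> L"
  proof (rule tendsto_fpsI)
    fix j
    show "eventually (\<lambda>n. fps_nth (P n) j = fps_nth L j) sequentially"
      using eventually_ge_at_top[of j] by eventually_elim (unfold L_def fps_nth_Abs_fps, rule stable)
  qed
  moreover have L0: "fps_nth L 0 = 1"
    using assms by (simp add: L_def P_def)
  ultimately have "raw_has_prod (\<lambda>m. 1 - fps_X ^ (k * Suc m)) 0 L"
    unfolding raw_has_prod_def P_def[abs_def] add_0_right by auto
  hence *: "(\<lambda>m. 1 - fps_X ^ (k * Suc m)) has_prod L"
    by (simp add: has_prod_def)
  hence "qprod k = L"
    unfolding qprod_def by (metis has_prod_unique)
  with * L0 show "(\<lambda>m. 1 - fps_X ^ (k * Suc m)) has_prod qprod k" "fps_nth (qprod k) 0 = 1"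
    by simp_all
qed

lemma c_gf_eq: "c_gf * (qprod 1 * qprod 2) = fps_X * qprod 6 ^ 3"
proof -
  have "fps_right_inverse (qprod 1 * qprod 2) 1 * (qprod 1 * qprod 2) = 1"
    by (subst mult.commute, rule fps_right_inverse) (simp add: has_prod_qprod(2))
  thus ?thesis
    unfolding c_gf_def by (simp only: mult.assoc mult_1_right)
qed

end

theory Submission 
  imports Defs
begin

text \<open>
  Write \<open>f\<^sub>k\<close> for the product \<open>(q\<^sup>k; q\<^sup>k)\<^sub>\<infinity>\<close> and \<open>F = f\<^sub>1 f\<^sub>2\<close>, so that the generating function is \<open>q f\<^sub>6\<^sup>3 / F\<close>.
  Gauss's identities give \<open>F = \<phi>(-q) \<psi>(q)\<close>, with \<open>\<phi>\<close> the theta series of the squares and \<open>\<psi>\<close> that of the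
  triangular numbers. Squares and triangular numbers are easily sorted modulo 3, and this yields
  \<open>F = A - q B - 2 q\<^sup>2 C\<close>, where \<open>A\<close>, \<open>C\<close> and \<open>B = f\<^sub>9 f\<^sub>1\<^sub>8\<close> are series in \<open>q\<^sup>3\<close> with \<open>A C = B\<^sup>2\<close>
  (\<open>qprod_pair_trisect\<close>). All product formulas used for this are cases of the Jacobi triple product
  (\<open>jacobi_triple_product\<close>), obtained as a limit of a finite identity with Gaussian binomials.

  The relation \<open>A C = B\<^sup>2\<close> makes a factor 3 appear twice. With the norm \<open>D\<close> of \<open>F\<close> over the series in \<open>q\<^sup>3\<close>, the
  terms of \<open>1 / F\<close> with exponents \<open>2\<close> modulo 3 form \<open>(q\<^sup>2 B\<^sup>2 + 2 q\<^sup>2 A C) / D = 3 q\<^sup>2 B\<^sup>2 / D\<close>. Therefore the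
  \<open>c(3 n)\<close> are generated by \<open>3 q\<^sup>3 B\<^sup>2 f\<^sub>6\<^sup>3 / D\<close>, and it remains to gain one more factor 3. Modulo 3 the norm is
  \<open>F\<^sup>3\<close>, which is \<open>f\<^sub>3 f\<^sub>6\<close>, so \<open>f\<^sub>6\<^sup>3 / D\<close> becomes \<open>f\<^sub>6\<^sup>2 / f\<^sub>3 = \<psi>(q\<^sup>3)\<close>. The exponents 6 modulo 9 are then met only by
  the part \<open>q\<^sup>3 \<psi>(q\<^sup>2\<^sup>7)\<close> of \<open>\<psi>(q\<^sup>3)\<close>, and among them the exponents 24 modulo 27 only by the part of \<open>B\<^sup>2\<close> with
  exponents 18 modulo 27. Since \<open>B\<close> is \<open>F\<close> at \<open>q\<^sup>9\<close>, the same dissection shows that this part is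
  \<open>q\<^sup>1\<^sup>8 (B'\<^sup>2 - 4 A' C') = -3 q\<^sup>1\<^sup>8 B'\<^sup>2\<close>, with \<open>A'\<close>, \<open>B'\<close>, \<open>C'\<close> the components of \<open>B\<close>. This is the second factor 3.
\<close>


section \<open>Limits of formal power series\<close>

lemma fps_X_power_dvd_iff:
  fixes f :: "'a :: comm_ring_1 fps"
  shows "fps_X ^ n dvd f \<longleftrightarrow> (\<forall>i<n. fps_nth f i = 0)"
proof
  assume "fps_X ^ n dvd f"
  then show "\<forall>i<n. fps_nth f i = 0"
    by (auto elim!: dvdE simp: fps_X_power_mult_nth)
next
  assume "\<forall>i<n. fps_nth f i = 0"
  then have "f = fps_X ^ n * fps_shift n f"
    by (intro fps_ext) (auto simp: fps_X_power_mult_nth)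
  then show "fps_X ^ n dvd f"
    by (rule dvdI)
qed

text \<open>
  Ideal-theoretic form of convergence; it makes the continuity of addition and multiplication a
  matter of divisibility.
\<close>

lemma tendsto_fps_iff_X_power_dvd:
  fixes f :: "'b \<Rightarrow> 'a :: comm_ring_1 fps"
  shows "(f \<longlongrightarrow> L) F \<longleftrightarrow> (\<forall>n. \<forall>\<^sub>F x in F. fps_X ^ n dvd f x - L)"
proof
  assume "(f \<longlongrightarrow> L) F"
  then have *: "\<forall>\<^sub>F x in F. fps_nth (f x) i = fps_nth L i" for i
    by (simp add: tendsto_fps_iff)
  have "\<forall>\<^sub>F x in F. \<forall>i\<in>{..<n}. fps_nth (f x) i = fps_nth L i" for n
    using * by (intro eventually_ball_finite) auto
  then show "\<forall>n. \<forall>\<^sub>F x in F. fps_X ^ n dvd f x - L"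
    by (simp add: fps_X_power_dvd_iff Ball_def)
next
  assume "\<forall>n. \<forall>\<^sub>F x in F. fps_X ^ n dvd f x - L"
  then have *: "\<forall>\<^sub>F x in F. fps_X ^ Suc n dvd f x - L" for n
    by blast
  show "(f \<longlongrightarrow> L) F"
  proof (rule tendsto_fpsI)
    fix n
    show "\<forall>\<^sub>F x in F. fps_nth (f x) n = fps_nth L n"
      using *[of n] by eventually_elim (unfold fps_X_power_dvd_iff, auto)
  qed
qed

instance fps :: (comm_ring_1) topological_comm_monoid_add
proof
  fix a b :: "'a fps"
  show "((\<lambda>x. fst x + snd x) \<longlongrightarrow> a + b) (nhds a \<times>\<^sub>F nhds b)"
    unfolding tendsto_fps_iff_X_power_dvd
  proof
    fix n
    have "\<forall>\<^sub>F x in nhds c. fps_X ^ n dvd x - c" for c :: "'a fps"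
      using filterlim_ident[of "nhds c"]
      unfolding tendsto_fps_iff_X_power_dvd by blast
    from eventually_prodI[OF this this]
    show "\<forall>\<^sub>F x in nhds a \<times>\<^sub>F nhds b. fps_X ^ n dvd fst x + snd x - (a + b)"
    proof eventually_elim
      case (elim x)
      have "fst x + snd x - (a + b) = (fst x - a) + (snd x - b)" by simp
      with elim show ?case by (simp only: dvd_add)
    qed
  qed
qed

instance fps :: (comm_ring_1) topological_monoid_mult
proof
  fix a b :: "'a fps"
  show "((\<lambda>x. fst x * snd x) \<longlongrightarrow> a * b) (nhds a \<times>\<^sub>F nhds b)"
    unfolding tendsto_fps_iff_X_power_dvd
  proof
    fix n
    have "\<forall>\<^sub>F x in nhds c. fps_X ^ n dvd x - c" for c :: "'a fps"
      using filterlim_ident[of "nhds c"]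
      unfolding tendsto_fps_iff_X_power_dvd by blast
    from eventually_prodI[OF this this]
    show "\<forall>\<^sub>F x in nhds a \<times>\<^sub>F nhds b. fps_X ^ n dvd fst x * snd x - a * b"
    proof eventually_elim
      case (elim x)
      have "fst x * snd x - a * b = (fst x - a) * snd x + a * (snd x - b)"
        by (simp add: algebra_simps)
      with elim show ?case by (simp only: dvd_add dvd_mult dvd_mult2)
    qed
  qed
qed

section \<open>Gaussian binomial coefficients\<close>

text \<open>
  Defined by the Pascal recursion, because \<open>q\<close> will be a power of the formal variable and the usual
  quotient of products cannot be formed over the integers.
\<close>

fun gauss_binomial :: "'a :: comm_ring_1 \<Rightarrow> nat \<Rightarrow> nat \<Rightarrow> 'a" where
  "gauss_binomial q n 0 = 1"
| "gauss_binomial q 0 (Suc k) = 0"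
| "gauss_binomial q (Suc n) (Suc k) = gauss_binomial q n k + q ^ Suc k * gauss_binomial q n (Suc k)"

lemma gauss_binomial_eq_0: "n < k \<Longrightarrow> gauss_binomial q n k = 0"
  by (induction q n k rule: gauss_binomial.induct) auto

lemma gauss_binomial_self [simp]: "gauss_binomial q n n = 1"
  by (induction n) (simp_all add: gauss_binomial_eq_0)

text \<open>
  The Gaussian binomials obey two Pascal recursions; each of the two inductions in
  \<open>finite_triple_product\<close> consumes one of them.
\<close>

lemma gauss_binomial_Suc_Suc_dual:
  assumes "k \<le> n"
  shows "gauss_binomial q (Suc n) (Suc k) = q ^ (n - k) * gauss_binomial q n k + gauss_binomial q n (Suc k)"
  using assms
proof (induction n arbitrary: k)
  case (Suc n)
  show ?case
  proof (cases k)
    case 0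
    then show ?thesis using Suc.IH[of 0] by (simp add: algebra_simps)
  next
    case (Suc l)
    show ?thesis
    proof (cases "k = Suc n")
      case True
      then show ?thesis by (simp add: gauss_binomial_eq_0)
    next
      case False
      with Suc.prems Suc have l: "l \<le> n" "k \<le> n" by auto
      have "Suc k + (n - k) = Suc n" "(n - l) + k = Suc n" using l Suc by auto
      then have powers: "q ^ Suc k * q ^ (n - k) = q ^ (n - l) * q ^ k"
        by (simp only: power_add[symmetric])
      let ?g = "gauss_binomial q"
      have IH: "?g (Suc n) k = q ^ (n - l) * ?g n l + ?g n k"
        "?g (Suc n) (Suc k) = q ^ (n - k) * ?g n k + ?g n (Suc k)"
        using Suc.IH[of l] Suc.IH[of k] l Suc by simp_all
      have "?g (Suc (Suc n)) (Suc k) = ?g (Suc n) k + q ^ Suc k * ?g (Suc n) (Suc k)"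
        by (rule gauss_binomial.simps)
      also have "\<dots> = q ^ (n - l) * ?g n l + ?g n k + (q ^ Suc k * q ^ (n - k)) * ?g n k + q ^ Suc k * ?g n (Suc k)"
        unfolding IH by (simp only: algebra_simps)
      also have "\<dots> = q ^ (n - l) * (?g n l + q ^ k * ?g n k) + (?g n k + q ^ Suc k * ?g n (Suc k))"
        unfolding powers by (simp only: algebra_simps)
      also have "\<dots> = q ^ (Suc n - k) * ?g (Suc n) k + ?g (Suc n) (Suc k)"
        using Suc by simp
      finally show ?thesis .
    qed
  qed
qed simp

definition q_pochhammer :: "'a :: comm_ring_1 \<Rightarrow> nat \<Rightarrow> 'a" where
  "q_pochhammer q n = (\<Prod>i<n. 1 - q ^ Suc i)"

lemma q_pochhammer_0 [simp]: "q_pochhammer q 0 = 1"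
  and q_pochhammer_Suc: "q_pochhammer q (Suc n) = q_pochhammer q n * (1 - q ^ Suc n)"
  by (simp_all add: q_pochhammer_def)

text \<open>
  The closed form, cleared of denominators. Only through it does the limit
  of a central Gaussian binomial become visible.
\<close>

lemma gauss_binomial_mult_q_pochhammer:
  "gauss_binomial q (i + j) i * q_pochhammer q i * q_pochhammer q j = q_pochhammer q (i + j)"
proof (induction "i + j" arbitrary: i j)
  case (Suc n)
  show ?case
  proof (cases i; cases j)
    fix i' j' assume ij: "i = Suc i'" "j = Suc j'"
    have 1: "gauss_binomial q n i' * q_pochhammer q i' * q_pochhammer q j = q_pochhammer q n"
      using Suc.hyps(1)[of i' j] Suc.hyps(2) ij by simp
    have 2: "gauss_binomial q n i * q_pochhammer q i * q_pochhammer q j' = q_pochhammer q n"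
      using Suc.hyps(1)[of i j'] Suc.hyps(2) ij by simp
    have n: "i + j = Suc n" "n = i' + Suc j'" using Suc.hyps(2) ij by auto
    have "gauss_binomial q (i + j) i * q_pochhammer q i * q_pochhammer q j
      = (gauss_binomial q n i' * q_pochhammer q i' * q_pochhammer q j) * (1 - q ^ i)
        + q ^ i * (1 - q ^ j) * (gauss_binomial q n i * q_pochhammer q i * q_pochhammer q j')"
      unfolding n(1) unfolding ij by (simp add: q_pochhammer_Suc algebra_simps)
    also have "\<dots> = q_pochhammer q n * (1 - q ^ (i + j))"
      unfolding 1 2 by (simp add: algebra_simps power_add)
    also have "\<dots> = q_pochhammer q (i + j)"
      unfolding n(1) by (simp only: q_pochhammer_Suc)
    finally show ?thesis .
  qed (simp_all add: gauss_binomial_eq_0)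
qed simp

section \<open>Theta series and the Jacobi triple product\<close>

definition triangular :: "int \<Rightarrow> nat" where
  "triangular k = nat (k * (k + 1) div 2)"

lemma double_triangular: "2 * int (triangular k) = k * k + k"
proof -
  have "even (k * (k + 1))" by simp
  moreover have "k * (k + 1) \<ge> 0"
    by (cases "k \<ge> 0") (auto intro: mult_nonpos_nonpos)
  ultimately have "2 * int (triangular k) = k * (k + 1)" by (simp add: triangular_def)
  then show ?thesis by (simp add: algebra_simps)
qed

lemma triangular_step: "int (triangular (k + 1)) = int (triangular k) + k + 1"
  using double_triangular[of k] double_triangular[of "k + 1"] by (simp add: algebra_simps)

text \<open>
  The general term \<open>a\<^sup>k\<^sup>(\<^sup>k\<^sup>+\<^sup>1\<^sup>)\<^sup>/\<^sup>2 b\<^sup>k\<^sup>(\<^sup>k\<^sup>-\<^sup>1\<^sup>)\<^sup>/\<^sup>2\<close> of Ramanujan's theta function \<open>f(a, b)\<close>. In this form it needs no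
  negative exponents for negative \<open>k\<close>, so it makes sense in every commutative ring.
\<close>

definition theta_term :: "'a :: comm_ring_1 \<Rightarrow> 'a \<Rightarrow> int \<Rightarrow> 'a" where
  "theta_term a b k = a ^ triangular k * b ^ triangular (k - 1)"

text \<open>
  Going from index \<open>k\<close> to \<open>k + 1\<close> multiplies the term by \<open>a (a b)\<^sup>k\<close>. The extra power \<open>e\<close> keeps all
  exponents nonnegative.
\<close>

lemma theta_term_step:
  assumes "int e = m - k" "int m' = m"
  shows "(a * b) ^ e * theta_term a b (k + 1) = a * (a * b) ^ m' * theta_term a b k"
proof -
  have "e + triangular (k + 1) = Suc (m' + triangular k)" "e + triangular k = m' + triangular (k - 1)"
    using triangular_step[of k] triangular_step[of "k - 1"] assms by auto
  then have "a ^ (e + triangular (k + 1)) * b ^ (e + triangular k) = a ^ Suc (m' + triangular k) * b ^ (m' + triangular (k - 1))"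
    by simp
  then show ?thesis
    by (simp add: theta_term_def power_add power_mult_distrib mult_ac)
qed

lemma theta_term_swap: "theta_term b a k = theta_term a b (- k)"
proof -
  have "triangular (- k) = triangular (k - 1)" for k
    by (simp add: triangular_def algebra_simps)
  from this[of k] this[of "k + 1"] show ?thesis
    by (simp add: theta_term_def mult_ac)
qed

text \<open>
  Multiplying by the next factor \<open>1 + a (a b)\<^sup>m\<close> shifts the terms by one index, and the shifted and
  the unshifted sum combine by a Pascal recursion; a factor \<open>1 + b (a b)\<^sup>n\<close> does the same in the
  other direction.
\<close>

lemma finite_triple_product:
  fixes a b :: "'a :: comm_ring_1"
  shows "(\<Prod>i<m. 1 + a * (a * b) ^ i) * (\<Prod>i<n. 1 + b * (a * b) ^ i)
       = (\<Sum>j\<le>m + n. gauss_binomial (a * b) (m + n) j * theta_term a b (int j - int n))"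
proof (induction m)
  case 0
  show ?case
  proof (induction n)
    case 0
    show ?case by (simp add: theta_term_def triangular_def)
  next
    case (Suc n)
    let ?g = "gauss_binomial (a * b)" and ?t = "\<lambda>j. theta_term a b (int j - int n)"
    have step: "(a * b) ^ j * theta_term a b (int j - int (Suc n)) = b * (a * b) ^ n * ?t j" for j
      using theta_term_step[of j "int n" "int n - int j" n b a] 
      by (simp add: theta_term_swap[of a b] mult.commute[of b a] algebra_simps)
    let ?u = "\<lambda>j. theta_term a b (int j - int (Suc n))"
    have "(\<Sum>j\<le>Suc n. ?g (Suc n) j * ?u j)
      = (\<Sum>j\<le>n. ?g n j * ?t j)
        + (\<Sum>j\<le>Suc n. ?g n j * ((a * b) ^ j * ?u j))"
      by (simp add: sum.atMost_Suc_shift sum.distrib algebra_simps del: sum.atMost_Suc)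
    also have "(\<Sum>j\<le>Suc n. ?g n j * ((a * b) ^ j * ?u j)) = (\<Sum>j\<le>n. ?g n j * ((a * b) ^ j * ?u j))"
      by (simp add: gauss_binomial_eq_0)
    finally have "(\<Sum>j\<le>Suc n. ?g (Suc n) j * ?u j)
      = (\<Sum>j\<le>n. ?g n j * ?t j) + (\<Sum>j\<le>n. ?g n j * ((a * b) ^ j * ?u j))" .
    then show ?case
      using Suc unfolding step
      by (simp add: algebra_simps sum_distrib_left sum.distrib
          del: sum.atMost_Suc gauss_binomial.simps)
  qed
next
  case (Suc m)
  let ?g = "gauss_binomial (a * b)" and ?N = "m + n"
  have step: "(a * b) ^ (?N - j) * theta_term a b (int (Suc j) - int n)
    = a * (a * b) ^ m * theta_term a b (int j - int n)" if "j \<le> ?N" for j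
    using theta_term_step[of "?N - j" "int m" "int j - int n" m a b] that
    by (simp add: algebra_simps)
  have "(\<Sum>j\<le>Suc ?N. ?g (Suc ?N) j * theta_term a b (int j - int n))
      = theta_term a b (- int n) + (\<Sum>j\<le>?N. ?g ?N (Suc j) * theta_term a b (int (Suc j) - int n))
        + (\<Sum>j\<le>?N. ?g ?N j * ((a * b) ^ (?N - j) * theta_term a b (int (Suc j) - int n)))"
    by (simp add: sum.atMost_Suc_shift gauss_binomial_Suc_Suc_dual sum.distrib algebra_simps
        del: sum.atMost_Suc gauss_binomial.simps(3))
  also have "theta_term a b (- int n) + (\<Sum>j\<le>?N. ?g ?N (Suc j) * theta_term a b (int (Suc j) - int n))
      = (\<Sum>j\<le>Suc ?N. ?g ?N j * theta_term a b (int j - int n))"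
    by (simp add: sum.atMost_Suc_shift del: sum.atMost_Suc)
  also have "\<dots> = (\<Sum>j\<le>?N. ?g ?N j * theta_term a b (int j - int n))"
    by (simp add: gauss_binomial_eq_0)

  also have "(\<Sum>j\<le>?N. ?g ?N j * ((a * b) ^ (?N - j) * theta_term a b (int (Suc j) - int n)))
      = (\<Sum>j\<le>?N. ?g ?N j * (a * (a * b) ^ m * theta_term a b (int j - int n)))"
    by (intro sum.cong refl) (simp only: step atMost_iff)
  finally show ?case
    using Suc by (simp add: algebra_simps sum_distrib_left)
qed


lemma sum_shift_symmetric:
  fixes f :: "int \<Rightarrow> 'a :: comm_monoid_add"
  shows "(\<Sum>j\<le>m + m. f (int j - int m)) = (\<Sum>k=-int m..int m. f k)"
  by (rule sum.reindex_bij_witness[of _ "\<lambda>k. nat (k + int m)" "\<lambda>j. int j - int m"]) auto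

definition theta :: "int fps \<Rightarrow> int fps \<Rightarrow> int fps" where
  "theta a b = lim (\<lambda>m. \<Sum>k=-int m..int m. theta_term a b k)"

lemma triangular_ge: "k \<ge> 0 \<Longrightarrow> int (triangular k) \<ge> k" "k < 0 \<Longrightarrow> int (triangular k) \<ge> - k - 1"
proof -
  show "int (triangular k) \<ge> k" if "k \<ge> 0"
  proof -
    have "0 \<le> k * (k - 1)" using that by (cases "k = 0") auto
    also have "k * (k - 1) = 2 * (int (triangular k) - k)"
      using double_triangular[of k] by (simp add: algebra_simps)
    finally show ?thesis by simp
  qed
  show "int (triangular k) \<ge> - k - 1" if "k < 0"
  proof -
    have "2 * int (triangular k) = (- k) * (- k - 1)"
      using double_triangular[of k] by (simp add: algebra_simps)
    moreover have "2 * (- k - 1) \<le> (- k) * (- k - 1)" if "k \<noteq> - 1"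
      using that \<open>k < 0\<close> by (intro mult_right_mono) auto
    ultimately show ?thesis by (cases "k = - 1") auto
  qed
qed

text \<open>
  Both exponents in the term are at least \<open>\<bar>k\<bar> - 1\<close>. Hence the theta series converges.
\<close>

lemma power_dvd_theta_term:
  assumes "\<bar>k\<bar> > int n"
  shows "(a * b) ^ n dvd theta_term a b k"
proof -
  have "n \<le> triangular k" "n \<le> triangular (k - 1)"
    using triangular_ge[of k] triangular_ge[of "k - 1"] assms by (cases "k \<ge> 0"; cases "k \<ge> 1"; simp)+
  then show ?thesis
    unfolding theta_term_def power_mult_distrib by (intro mult_dvd_mono le_imp_power_dvd)
qed

lemma X_power_dvd_theta_term:
  assumes "a * b = fps_X ^ d" "d > 0" "\<bar>k\<bar> > int n"
  shows "fps_X ^ n dvd theta_term a b k"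
proof -
  have "n \<le> d * n" using assms by simp
  then have "fps_X ^ n dvd (a * b) ^ n"
    unfolding assms(1) power_mult[symmetric] by (rule le_imp_power_dvd)
  with power_dvd_theta_term[OF assms(3)] show ?thesis by (rule dvd_trans[rotated])
qed

lemma tendsto_theta:
  assumes "a * b = fps_X ^ d" "d > 0"
  shows "(\<lambda>m. \<Sum>k=-int m..int m. theta_term a b k) \<longlonglongrightarrow> theta a b"
proof -
  define S where "S m = (\<Sum>k=-int m..int m. theta_term a b k)" for m
  have step: "fps_X ^ n dvd S (Suc m) - S m" if "n \<le> m" for m n
  proof -
    have "{- int (Suc m)..int (Suc m)} = {- int m..int m} \<union> {- int (Suc m), int (Suc m)}"
      by auto
    then have "S (Suc m) = S m + (\<Sum>k\<in>{- int (Suc m), int (Suc m)}. theta_term a b k)"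
      unfolding S_def by (simp only:) (subst sum.union_disjoint, auto)
    then have "S (Suc m) - S m = (\<Sum>k\<in>{- int (Suc m), int (Suc m)}. theta_term a b k)"
      by simp
    also have "fps_X ^ n dvd \<dots>"
      using that by (intro dvd_sum X_power_dvd_theta_term[OF assms]) auto
    finally show ?thesis .
  qed
  have stable: "fps_X ^ n dvd S m - S n" if "n \<le> m" for m n
    using that
  proof (induction m rule: dec_induct)
    case (step m)
    have "S (Suc m) - S n = (S (Suc m) - S m) + (S m - S n)" by simp
    then show ?case using step \<open>\<And>m n. n \<le> m \<Longrightarrow> fps_X ^ n dvd S (Suc m) - S m\<close>
      by (simp only: dvd_add)
  qed simp
  define L where "L = Abs_fps (\<lambda>n. fps_nth (S (Suc n)) n)"
  have "S \<longlonglongrightarrow> L"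
  proof (rule tendsto_fpsI)
    fix n
    show "\<forall>\<^sub>F m in sequentially. fps_nth (S m) n = fps_nth L n"
      using eventually_ge_at_top[of "Suc n"]
    proof eventually_elim
      case (elim m)
      then show ?case
        using stable[OF elim] unfolding fps_X_power_dvd_iff by (auto simp: L_def)
    qed
  qed
  then have "S \<longlonglongrightarrow> theta a b"
    unfolding theta_def S_def by (simp add: limI)
  then show ?thesis by (simp add: S_def[abs_def])
qed

lemma tendsto_q_pochhammer:
  assumes "d > 0"
  shows "(\<lambda>m. q_pochhammer (fps_X ^ d) m) \<longlonglongrightarrow> qprod d"
  using has_prod_imp_tendsto'[OF has_prod_qprod(1)[OF assms]]
  by (simp only: q_pochhammer_def power_mult[symmetric])

lemma dvd_cancel_left_const_1:
  fixes f g :: "int fps"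
  assumes "fps_X ^ n dvd f * g" "fps_nth f 0 = 1"
  shows "fps_X ^ n dvd g"
proof -
  have "f * fps_right_inverse f 1 = 1"
    using assms by (intro fps_right_inverse) simp
  then have "g = (f * g) * fps_right_inverse f 1"
    by (metis mult.commute mult.left_commute mult.right_neutral)
  with assms(1) show ?thesis by (metis dvd_mult2)
qed

text \<open>
  Multiplied by \<open>(q; q)\<^sub>\<infinity>\<close> with \<open>q = a b\<close>, the Gaussian binomials in \<open>finite_triple_product\<close> tend to 1
  as long as their index and its complement both grow, and the terms where one of the two stays small are
  negligible because they lie far out in the theta series. The product side stays unevaluated:
  every application first telescopes the finite product.
\<close>

lemma jacobi_triple_product:
  fixes a b :: "int fps"
  assumes ab: "a * b = fps_X ^ d" and d: "d > 0"
  shows "(\<lambda>m. qprod d * ((\<Prod>i<m. 1 + a * (a * b) ^ i) * (\<Prod>i<m. 1 + b * (a * b) ^ i))) \<longlonglongrightarrow> theta a b"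
proof -
  define R where "R m = (\<Prod>i<m. 1 + a * (a * b) ^ i) * (\<Prod>i<m. 1 + b * (a * b) ^ i)" for m
  define S where "S m = (\<Sum>k=-int m..int m. theta_term a b k)" for m
  define E where "E m = q_pochhammer (a * b) m" for m
  let ?g = "gauss_binomial (a * b)"
  have "(\<lambda>m. qprod d * R m - S m) \<longlonglongrightarrow> 0"
    unfolding tendsto_fps_iff_X_power_dvd diff_zero
  proof
    fix n
    have "\<forall>\<^sub>F m in sequentially. fps_X ^ n dvd E m - qprod d"
      using tendsto_q_pochhammer[OF d] unfolding E_def ab tendsto_fps_iff_X_power_dvd by blast
    then obtain i0 where E: "fps_X ^ n dvd E i - qprod d" if "i \<ge> i0" for i
      unfolding eventually_sequentially by blast
    \<comment> \<open>Cancelling one \<open>(q; q)\<^sub>\<infinity>\<close> from the closed form in which all three factors are replaced by it.\<close>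
    have large: "fps_X ^ n dvd qprod d * ?g (i + j) i - 1" if "i \<ge> i0" "j \<ge> i0" for i j
    proof (rule dvd_cancel_left_const_1)
      have "qprod d * (qprod d * ?g (i + j) i - 1)
        = (E (i + j) - qprod d) - ?g (i + j) i * (E i - qprod d) * E j
          - ?g (i + j) i * qprod d * (E j - qprod d)"
        using gauss_binomial_mult_q_pochhammer[of "a * b" i j]
        by (simp add: E_def algebra_simps)
      also have "fps_X ^ n dvd \<dots>"
        using that by (intro dvd_diff[OF dvd_diff] E dvd_mult2[OF dvd_mult] dvd_mult) auto
      finally show "fps_X ^ n dvd qprod d * (qprod d * ?g (i + j) i - 1)" .
    qed (simp add: has_prod_qprod(2) d)
    show "\<forall>\<^sub>F m in sequentially. fps_X ^ n dvd qprod d * R m - S m"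
      using eventually_ge_at_top[of "i0 + n"]
    proof eventually_elim
      case (elim m)
      have "qprod d * R m - S m
        = (\<Sum>j\<le>m + m. (qprod d * ?g (m + m) j - 1) * theta_term a b (int j - int m))"
        unfolding R_def S_def finite_triple_product sum_shift_symmetric[symmetric]
        by (simp add: sum_distrib_left sum_subtractf algebra_simps)
      also have "fps_X ^ n dvd \<dots>"
      proof (rule dvd_sum)
        fix j assume j: "j \<in> {..m + m}"
        show "fps_X ^ n dvd (qprod d * ?g (m + m) j - 1) * theta_term a b (int j - int m)"
        proof (cases "i0 \<le> j \<and> i0 \<le> m + m - j")
          case True
          with large[of j "m + m - j"] j show ?thesis by (simp add: dvd_mult2)
        next
          case False
          then have "\<bar>int j - int m\<bar> > int n" using elim j by auto
          then show ?thesis by (intro dvd_mult X_power_dvd_theta_term[OF ab d])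
        qed
      qed
      finally show ?case .
    qed
  qed
  from tendsto_add[OF this tendsto_theta[OF ab d]] show ?thesis
    by (simp add: S_def R_def)
qed


section \<open>Four theta series as infinite products\<close>

lemma prod_odd_mult_q_pochhammer:
  fixes q :: "'a :: comm_ring_1"
  shows "(\<Prod>i<m. 1 - q * (q ^ 2) ^ i) * q_pochhammer (q ^ 2) m = q_pochhammer q (2 * m)"
proof (induction m)
  case (Suc m)
  have "q * (q ^ 2) ^ m = q ^ Suc (2 * m)" "(q ^ 2) ^ Suc m = q ^ Suc (Suc (2 * m))"
    by (simp_all add: power_mult power2_eq_square)
  moreover have "2 * Suc m = Suc (Suc (2 * m))" by simp
  ultimately show ?case
    unfolding \<open>2 * Suc m = _\<close> q_pochhammer_Suc prod.lessThan_Suc Suc[symmetric]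
    by (simp only: mult_ac)
qed simp

lemma prod_plus_mult_q_pochhammer:
  fixes q :: "'a :: comm_ring_1"
  shows "(\<Prod>i<m. 1 + q ^ Suc i) * q_pochhammer q m = q_pochhammer (q ^ 2) m"
proof (induction m)
  case (Suc m)
  have "1 - (q ^ 2) ^ Suc m = (1 + q ^ Suc m) * (1 - q ^ Suc m)"
    by (simp add: power2_eq_square algebra_simps power_mult_distrib)
  then show ?case
    by (simp only: q_pochhammer_Suc prod.lessThan_Suc Suc[symmetric] mult_ac)
qed simp

lemma tendsto_q_pochhammer_mult:
  assumes "d > 0" "r > 0"
  shows "(\<lambda>m. q_pochhammer (fps_X ^ d) (r * m)) \<longlonglongrightarrow> qprod d"
proof -
  have "strict_mono (\<lambda>m. r * m)" using assms by (auto intro: strict_monoI)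
  from LIMSEQ_subseq_LIMSEQ[OF tendsto_q_pochhammer[OF assms(1)] this] show ?thesis
    by (simp add: o_def)
qed

lemma qprod_nonzero: "d > 0 \<Longrightarrow> qprod d \<noteq> 0"
  using has_prod_qprod(2)[of d] by auto

text \<open>
  Gauss's identity for \<open>\<phi>(-q) = \<Sum> (-1)\<^sup>k q\<^sup>k\<^sup>*\<^sup>k\<close>, with \<open>q\<close> replaced by its \<open>d\<close>-th power.
\<close>

lemma theta_phi_eq:
  assumes d: "d > 0"
  shows "theta (- (fps_X ^ d)) (- (fps_X ^ d)) * qprod (2 * d) = qprod d ^ 2"
proof -
  define q :: "int fps" where "q = fps_X ^ d"
  define A where "A m = (\<Prod>i<m. 1 - q * (q ^ 2) ^ i)" for m
  have q2: "q ^ 2 = fps_X ^ (2 * d)" by (simp add: q_def power_mult mult.commute)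
  have A: "A m * q_pochhammer (q ^ 2) m = q_pochhammer q (2 * m)" for m
    unfolding A_def by (rule prod_odd_mult_q_pochhammer)
  have "(\<lambda>m. qprod (2 * d) * A m ^ 2) \<longlonglongrightarrow> theta (- q) (- q)"
    using jacobi_triple_product[of "- q" "- q" "2 * d"] d q2
    by (simp add: A_def power2_eq_square)
  then have lhs: "(\<lambda>m. qprod (2 * d) * A m ^ 2 * q_pochhammer (q ^ 2) m ^ 2)
      \<longlonglongrightarrow> theta (- q) (- q) * qprod (2 * d) ^ 2"
    unfolding q2 using d by (intro tendsto_mult tendsto_power_strong[OF _ tendsto_const] tendsto_q_pochhammer) auto
  have eq: "(\<lambda>m. qprod (2 * d) * A m ^ 2 * q_pochhammer (q ^ 2) m ^ 2)
      = (\<lambda>m. qprod (2 * d) * q_pochhammer q (2 * m) ^ 2)"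
    by (simp add: A[symmetric] power_mult_distrib mult.assoc)
  have rhs: "(\<lambda>m. qprod (2 * d) * q_pochhammer q (2 * m) ^ 2) \<longlonglongrightarrow> qprod (2 * d) * qprod d ^ 2"
    unfolding q_def using d by (intro tendsto_mult tendsto_power_strong[OF _ tendsto_const] tendsto_q_pochhammer_mult tendsto_const) auto
  have "theta (- q) (- q) * qprod (2 * d) ^ 2 = qprod (2 * d) * qprod d ^ 2"
    using lhs rhs unfolding eq by (rule LIMSEQ_unique)
  then have "qprod (2 * d) * (theta (- q) (- q) * qprod (2 * d)) = qprod (2 * d) * qprod d ^ 2"
    by (simp add: power2_eq_square mult_ac)
  then show ?thesis
    using qprod_nonzero[of "2 * d"] d by (simp add: q_def)
qed

text \<open>
  Gauss's identity for the triangular number series \<open>\<psi>(q)\<close>. Summing over all integers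
  meets each triangular number twice, which is where the factor 2 comes from.
\<close>

lemma theta_psi_eq:
  assumes d: "d > 0"
  shows "theta (fps_X ^ d) 1 * qprod d = 2 * qprod (2 * d) ^ 2"
proof -
  define q :: "int fps" where "q = fps_X ^ d"
  define A where "A m = (\<Prod>i<m. 1 + q ^ Suc i)" for m
  have q2: "q ^ 2 = fps_X ^ (2 * d)" by (simp add: q_def power_mult mult.commute)
  have A: "A m * q_pochhammer q m = q_pochhammer (q ^ 2) m" for m
    unfolding A_def by (rule prod_plus_mult_q_pochhammer)
  \<comment> \<open>The triple product with \<open>b = 1\<close> starts at the factor \<open>1 + q\<^sup>0 = 2\<close>.\<close>
  have shift: "(\<Prod>i<m. 1 + q ^ i) * (1 + q ^ m) = 2 * A m" for m
    using prod.lessThan_Suc_shift[of "\<lambda>i. 1 + q ^ i" m] by (simp add: A_def)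
  have "(\<lambda>m. qprod d * (A m * (\<Prod>i<m. 1 + q ^ i))) \<longlonglongrightarrow> theta q 1"
    using jacobi_triple_product[of q 1 d] d by (simp add: A_def q_def)
  moreover have "(\<lambda>m. 1 + q ^ m) \<longlonglongrightarrow> 1"
    unfolding tendsto_fps_iff_X_power_dvd
  proof
    fix n
    have "fps_X ^ n dvd q ^ m" if "n \<le> m" for m
      unfolding q_def power_mult[symmetric]
    proof (rule le_imp_power_dvd)
      have "m \<le> d * m" using d by simp
      with that show "n \<le> d * m" by linarith
    qed
    then have "fps_X ^ n dvd 1 + q ^ m - 1" if "n \<le> m" for m
      using that by simp
    then show "\<forall>\<^sub>F m in sequentially. fps_X ^ n dvd 1 + q ^ m - 1"
      unfolding eventually_sequentially by blast
  qed
  ultimately have lhs: "(\<lambda>m. qprod d * (A m * (\<Prod>i<m. 1 + q ^ i)) * (1 + q ^ m) * q_pochhammer q m ^ 2)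
      \<longlonglongrightarrow> theta q 1 * 1 * qprod d ^ 2"
    unfolding q_def using d by (intro tendsto_mult tendsto_power_strong[OF _ tendsto_const] tendsto_q_pochhammer) auto
  have eq: "qprod d * (A m * (\<Prod>i<m. 1 + q ^ i)) * (1 + q ^ m) * q_pochhammer q m ^ 2
      = 2 * qprod d * q_pochhammer (q ^ 2) m ^ 2" for m
  proof -
    have "qprod d * (A m * (\<Prod>i<m. 1 + q ^ i)) * (1 + q ^ m) * q_pochhammer q m ^ 2
      = qprod d * A m * ((\<Prod>i<m. 1 + q ^ i) * (1 + q ^ m)) * q_pochhammer q m ^ 2"
      by (simp only: mult_ac)
    also have "\<dots> = 2 * qprod d * (A m * q_pochhammer q m) ^ 2"
      unfolding shift by (simp add: power2_eq_square mult_ac)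
    finally show ?thesis unfolding A .
  qed
  have rhs: "(\<lambda>m. 2 * qprod d * q_pochhammer (q ^ 2) m ^ 2) \<longlonglongrightarrow> 2 * qprod d * qprod (2 * d) ^ 2"
    unfolding q2 using d by (intro tendsto_mult tendsto_power_strong[OF _ tendsto_const] tendsto_q_pochhammer tendsto_const) auto
  have "theta q 1 * 1 * qprod d ^ 2 = 2 * qprod d * qprod (2 * d) ^ 2"
    using lhs rhs unfolding eq by (rule LIMSEQ_unique)
  then have "qprod d * (theta q 1 * qprod d) = qprod d * (2 * qprod (2 * d) ^ 2)"
    by (simp add: power2_eq_square mult_ac)
  then show ?thesis
    using qprod_nonzero[of d] d by (simp add: q_def)
qed

text \<open>
  The factors \<open>1 + q\<^sup>i\<close> with \<open>i\<close> congruent to 1 or 2 modulo 3 are all the factors \<open>1 + q\<^sup>i\<close> without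
  those at multiples of 3.
\<close>

lemma theta_q2_q_eq:
  assumes d: "d > 0"
  shows "theta (fps_X ^ (2 * d)) (fps_X ^ d) * (qprod (6 * d) * qprod d) = qprod (2 * d) * qprod (3 * d) ^ 2"
proof -
  define q :: "int fps" where "q = fps_X ^ d"
  define R where "R m = (\<Prod>i<m. 1 + q ^ 2 * (q ^ 3) ^ i) * (\<Prod>i<m. 1 + q * (q ^ 3) ^ i)" for m
  have powers: "q ^ 2 = fps_X ^ (2 * d)" "q ^ 3 = fps_X ^ (3 * d)" "(q ^ 3) ^ 2 = fps_X ^ (6 * d)"
    by (simp_all add: q_def mult.commute flip: power_mult)
  have R: "R m * (\<Prod>i<m. 1 + (q ^ 3) ^ Suc i) = (\<Prod>i<3 * m. 1 + q ^ Suc i)" for m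
  proof (induction m)
    case (Suc m)
    have *: "q * (q ^ 3) ^ m = q ^ Suc (3 * m)" "q ^ 2 * (q ^ 3) ^ m = q ^ Suc (Suc (3 * m))"
      "(q ^ 3) ^ Suc m = q ^ Suc (Suc (Suc (3 * m)))" "3 * Suc m = Suc (Suc (Suc (3 * m)))"
      by ((simp only: power_mult[symmetric] power_add[symmetric] power_Suc[symmetric],
          (rule arg_cong[of _ _ "power q"], simp)?)+, simp)
    show ?case
      unfolding R_def prod.lessThan_Suc *(4) *(1-3) Suc[symmetric]
      by (simp only: R_def mult_ac)
  qed (simp add: R_def)
  have finite: "R m * (q_pochhammer ((q ^ 3) ^ 2) m * q_pochhammer q (3 * m))
    = q_pochhammer (q ^ 2) (3 * m) * q_pochhammer (q ^ 3) m" for m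
  proof -
    have "R m * (q_pochhammer ((q ^ 3) ^ 2) m * q_pochhammer q (3 * m))
      = (R m * (\<Prod>i<m. 1 + (q ^ 3) ^ Suc i)) * q_pochhammer q (3 * m) * q_pochhammer (q ^ 3) m"
      by (simp only: prod_plus_mult_q_pochhammer[symmetric] mult_ac)
    then show ?thesis
      unfolding R prod_plus_mult_q_pochhammer .
  qed
  have "q ^ 2 * q = q ^ 3" by (simp add: power2_eq_square power3_eq_cube)
  then have "(\<lambda>m. qprod (3 * d) * R m) \<longlonglongrightarrow> theta (q ^ 2) q"
    using jacobi_triple_product[of "q ^ 2" q "3 * d"] d powers(2) by (simp add: R_def)
  then have lhs: "(\<lambda>m. qprod (3 * d) * R m * (q_pochhammer ((q ^ 3) ^ 2) m * q_pochhammer q (3 * m)))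
     \<longlonglongrightarrow> theta (q ^ 2) q * (qprod (6 * d) * qprod d)"
    unfolding powers(3) unfolding powers(1,2) unfolding q_def using d
    by (intro tendsto_mult tendsto_q_pochhammer tendsto_q_pochhammer_mult) auto
  have eq: "(\<lambda>m. qprod (3 * d) * R m * (q_pochhammer ((q ^ 3) ^ 2) m * q_pochhammer q (3 * m)))
    = (\<lambda>m. qprod (3 * d) * (q_pochhammer (q ^ 2) (3 * m) * q_pochhammer (q ^ 3) m))"
    by (simp only: finite mult.assoc)
  have rhs: "(\<lambda>m. qprod (3 * d) * (q_pochhammer (q ^ 2) (3 * m) * q_pochhammer (q ^ 3) m))
     \<longlonglongrightarrow> qprod (3 * d) * (qprod (2 * d) * qprod (3 * d))"
    unfolding powers(3) unfolding powers(1,2) using d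
    by (intro tendsto_mult tendsto_q_pochhammer tendsto_q_pochhammer_mult tendsto_const) auto
  have "theta (q ^ 2) q * (qprod (6 * d) * qprod d) = qprod (3 * d) * (qprod (2 * d) * qprod (3 * d))"
    using lhs rhs unfolding eq by (rule LIMSEQ_unique)
  then show ?thesis
    unfolding powers(3) unfolding powers(1,2) by (simp add: q_def power2_eq_square mult_ac)
qed

text \<open>
  This series is usually called \<open>\<Omega>(-q) = \<Sum> (-1)\<^sup>k q\<^sup>3\<^sup>k\<^sup>*\<^sup>k\<^sup>+\<^sup>2\<^sup>k\<close>. The factors \<open>1 - q\<^sup>i\<close> with \<open>i\<close> congruent to 1 or 5
  modulo 6 are those at odd \<open>i\<close> without those at odd multiples of 3.
\<close>

lemma theta_Omega_eq:
  assumes d: "d > 0"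
  shows "theta (- (fps_X ^ (5 * d))) (- (fps_X ^ d)) * (qprod (3 * d) * qprod (2 * d)) = qprod d * qprod (6 * d) ^ 2"
proof -
  define q :: "int fps" where "q = fps_X ^ d"
  define R where "R m = (\<Prod>i<m. 1 - q ^ 5 * (q ^ 6) ^ i) * (\<Prod>i<m. 1 - q * (q ^ 6) ^ i)" for m
  have powers: "q ^ 2 = fps_X ^ (2 * d)" "q ^ 3 = fps_X ^ (3 * d)" "q ^ 5 = fps_X ^ (5 * d)"
     "(q ^ 3) ^ 2 = fps_X ^ (6 * d)"
    by (simp_all add: q_def mult.commute flip: power_mult)
  have q6: "q ^ 6 = (q ^ 3) ^ 2" by (simp flip: power_mult)
  have R: "R m * (\<Prod>i<m. 1 - q ^ 3 * ((q ^ 3) ^ 2) ^ i) = (\<Prod>i<3 * m. 1 - q * (q ^ 2) ^ i)" for m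
  proof (induction m)
    case (Suc m)
    have *: "q ^ 3 * ((q ^ 3) ^ 2) ^ m = q * (q ^ 2) ^ Suc (3 * m)" 
       "q ^ 5 * (q ^ 6) ^ m = q * (q ^ 2) ^ Suc (Suc (3 * m))"
      "q * (q ^ 6) ^ m = q * (q ^ 2) ^ (3 * m)" "3 * Suc m = Suc (Suc (Suc (3 * m)))"
      by ((simp only: power_mult[symmetric] power_add[symmetric] power_Suc[symmetric],
          (rule arg_cong[of _ _ "power q"], simp)?)+, simp)
    show ?case
      unfolding R_def prod.lessThan_Suc *(4) *(1-3) Suc[symmetric]
      by (simp only: R_def mult_ac)
  qed (simp add: R_def)
  have finite: "R m * (q_pochhammer (q ^ 3) (2 * m) * q_pochhammer (q ^ 2) (3 * m))
    = q_pochhammer q (6 * m) * q_pochhammer ((q ^ 3) ^ 2) m" for m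
  proof -
    have "R m * (q_pochhammer (q ^ 3) (2 * m) * q_pochhammer (q ^ 2) (3 * m))
      = (R m * (\<Prod>i<m. 1 - q ^ 3 * ((q ^ 3) ^ 2) ^ i)) * q_pochhammer (q ^ 2) (3 * m)
        * q_pochhammer ((q ^ 3) ^ 2) m"
      unfolding prod_odd_mult_q_pochhammer[of "q ^ 3", symmetric] by (simp only: mult_ac)
    also have "\<dots> = q_pochhammer q (2 * (3 * m)) * q_pochhammer ((q ^ 3) ^ 2) m"
      unfolding R prod_odd_mult_q_pochhammer ..
    finally show ?thesis by simp
  qed
  have "q ^ 5 * q = q ^ 6" by (simp add: numeral_eq_Suc mult_ac)
  moreover have "q ^ 6 = fps_X ^ (6 * d)" by (simp only: q6 powers(4))
  ultimately have "(\<lambda>m. qprod (6 * d) * R m) \<longlonglongrightarrow> theta (- (q ^ 5)) (- q)"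
    using jacobi_triple_product[of "- (q ^ 5)" "- q" "6 * d"] d by (simp add: R_def)
  then have lhs: "(\<lambda>m. qprod (6 * d) * R m * (q_pochhammer (q ^ 3) (2 * m) * q_pochhammer (q ^ 2) (3 * m)))
     \<longlonglongrightarrow> theta (- (q ^ 5)) (- q) * (qprod (3 * d) * qprod (2 * d))"
    unfolding powers(4) unfolding powers(1-3) using d
    by (intro tendsto_mult tendsto_q_pochhammer_mult) auto
  have eq: "(\<lambda>m. qprod (6 * d) * R m * (q_pochhammer (q ^ 3) (2 * m) * q_pochhammer (q ^ 2) (3 * m)))
    = (\<lambda>m. qprod (6 * d) * (q_pochhammer q (6 * m) * q_pochhammer ((q ^ 3) ^ 2) m))"
    by (simp only: finite mult.assoc)
  have rhs: "(\<lambda>m. qprod (6 * d) * (q_pochhammer q (6 * m) * q_pochhammer ((q ^ 3) ^ 2) m))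
     \<longlonglongrightarrow> qprod (6 * d) * (qprod d * qprod (6 * d))"
    unfolding powers(4) unfolding powers(1-3) unfolding q_def using d
    by (intro tendsto_mult tendsto_q_pochhammer tendsto_q_pochhammer_mult tendsto_const) auto
  have "theta (- (q ^ 5)) (- q) * (qprod (3 * d) * qprod (2 * d)) = qprod (6 * d) * (qprod d * qprod (6 * d))"
    using lhs rhs unfolding eq by (rule LIMSEQ_unique)
  then show ?thesis
    unfolding powers(4) unfolding powers(1-3) by (simp add: q_def power2_eq_square mult_ac)
qed

text \<open>
  The key relation between the components of \<open>\<phi>\<close> and \<open>\<psi>\<close>: in \<open>qprod_pair_trisect\<close> it ties the outer two
  components to the middle one.
\<close>

lemma theta_q2_q_mult_theta_Omega:
  assumes d: "d > 0"
  shows "theta (fps_X ^ (2 * d)) (fps_X ^ d) * theta (- (fps_X ^ (5 * d))) (- (fps_X ^ d))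
    = qprod (3 * d) * qprod (6 * d)"
proof -
  let ?P = "theta (fps_X ^ (2 * d)) (fps_X ^ d)" and ?W = "theta (- (fps_X ^ (5 * d))) (- (fps_X ^ d))"
  let ?c = "qprod (6 * d) * qprod d * qprod (3 * d) * qprod (2 * d)"
  have "(?P * ?W) * ?c = (?P * (qprod (6 * d) * qprod d)) * (?W * (qprod (3 * d) * qprod (2 * d)))"
    by (simp only: mult_ac)
  also have "\<dots> = (qprod (3 * d) * qprod (6 * d)) * ?c"
    unfolding theta_q2_q_eq[OF d] theta_Omega_eq[OF d] by (simp add: power2_eq_square mult_ac)
  finally show ?thesis
    using d by (simp add: qprod_nonzero)
qed

section \<open>Splitting the theta series modulo 3\<close>

lemma sum_symmetric_Suc:
  fixes f :: "int \<Rightarrow> 'a :: comm_monoid_add"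
  shows "(\<Sum>k=-int (Suc m)..int (Suc m). f k) = (\<Sum>k=-int m..int m. f k) + f (int m + 1) + f (- int m - 1)"
proof -
  have "{- int (Suc m)..int (Suc m)} = insert (int m + 1) (insert (- int m - 1) {- int m..int m})"
    by auto
  then show ?thesis by (simp add: add_ac)
qed

lemma sum_symmetric_trisect:
  fixes f :: "int \<Rightarrow> 'a :: comm_monoid_add"
  shows "(\<Sum>k=-int (3 * m + 1)..int (3 * m + 1). f k)
    = (\<Sum>k=-int m..int m. f (3 * k)) + (\<Sum>k=-int m..int m. f (3 * k + 1)) + (\<Sum>k=-int m..int m. f (3 * k - 1))"
proof (induction m)
  case 0
  have "{-1..1::int} = {-1, 0, 1}" by auto
  then show ?case by (simp add: add_ac)
next
  case (Suc m)
  have "3 * Suc m + 1 = Suc (Suc (Suc (3 * m + 1)))" by simp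
  moreover have
    "int (3 * m + 1) + 1 = 3 * (int m + 1) - 1"
    "int (Suc (3 * m + 1)) + 1 = 3 * (int m + 1)"
    "int (Suc (Suc (3 * m + 1))) + 1 = 3 * (int m + 1) + 1"
    "- int (3 * m + 1) - 1 = 3 * (- int m - 1) + 1"
    "- int (Suc (3 * m + 1)) - 1 = 3 * (- int m - 1)"
    "- int (Suc (Suc (3 * m + 1))) - 1 = 3 * (- int m - 1) - 1"
    by simp_all
  ultimately show ?case
    by (simp only: sum_symmetric_Suc Suc) (simp only: add_ac)
qed

lemma sum_symmetric_uminus:
  fixes f :: "int \<Rightarrow> 'a :: comm_monoid_add"
  shows "(\<Sum>k=-int m..int m. f (- k)) = (\<Sum>k=-int m..int m. f k)"
  by (rule sum.reindex_bij_witness[of _ uminus uminus]) auto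


text \<open>
  The exponent is \<open>k\<^sup>2\<close>, and \<open>(3 k)\<^sup>2 = 9 k\<^sup>2\<close>, \<open>(3 k + 1)\<^sup>2 = 3 (3 k\<^sup>2 + 2 k) + 1\<close>.
\<close>

lemma theta_term_phi_trisect:
  fixes x :: "'a :: comm_ring_1"
  shows "theta_term (- x) (- x) (3 * k) = theta_term (- (x ^ 9)) (- (x ^ 9)) k"
    and "theta_term (- x) (- x) (3 * k + 1) = - x * theta_term (- (x ^ 15)) (- (x ^ 3)) k"
proof -
  have minus: "- (x ^ 9) = (- x) ^ 9" "- (x ^ 15) = (- x) ^ 15" "- (x ^ 3) = (- x) ^ 3"
    by simp_all
  have "triangular (3 * k) + triangular (3 * k - 1) = 9 * triangular k + 9 * triangular (k - 1)"
    using double_triangular[of "3 * k"] double_triangular[of "3 * k - 1"] double_triangular[of k] double_triangular[of "k - 1"]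
    by (simp add: algebra_simps)
  then show "theta_term (- x) (- x) (3 * k) = theta_term (- (x ^ 9)) (- (x ^ 9)) k"
    unfolding theta_term_def minus by (simp only: power_add[symmetric] power_mult[symmetric])
  have "triangular (3 * k + 1) + triangular (3 * k + 1 - 1) = Suc (15 * triangular k + 3 * triangular (k - 1))"
    using double_triangular[of "3 * k"] double_triangular[of "3 * k + 1"] double_triangular[of k] double_triangular[of "k - 1"]
    by (simp add: algebra_simps)
  then show "theta_term (- x) (- x) (3 * k + 1) = - x * theta_term (- (x ^ 15)) (- (x ^ 3)) k"
    unfolding theta_term_def minus
    by (simp only: power_add[symmetric] power_mult[symmetric] power_Suc[symmetric])
qed

text \<open>
  The triangular numbers with index \<open>3 k\<close> or \<open>3 k - 1\<close> are three times a generalized pentagonal number,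
  and the one with index \<open>3 k + 1\<close> is \<open>9 T + 1\<close> for the triangular number \<open>T\<close> with index \<open>k\<close>.
\<close>

lemma theta_term_psi_trisect:
  fixes x :: "'a :: comm_ring_1"
  shows "theta_term x 1 (3 * k) = theta_term (x ^ 6) (x ^ 3) k"
    and "theta_term x 1 (3 * k + 1) = x * theta_term (x ^ 9) 1 k"
    and "theta_term x 1 (3 * k - 1) = theta_term (x ^ 6) (x ^ 3) (- k)"
proof -
  have "triangular (3 * k) = 6 * triangular k + 3 * triangular (k - 1)"
    using double_triangular[of "3 * k"] double_triangular[of k] double_triangular[of "k - 1"]
    by (simp add: algebra_simps)
  then show "theta_term x 1 (3 * k) = theta_term (x ^ 6) (x ^ 3) k"
    by (simp add: theta_term_def power_add power_mult)
  have "triangular (3 * k + 1) = Suc (9 * triangular k)"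
    using double_triangular[of "3 * k + 1"] double_triangular[of k] by (simp add: algebra_simps)
  then show "theta_term x 1 (3 * k + 1) = x * theta_term (x ^ 9) 1 k"
    by (simp add: theta_term_def power_mult)
  have "triangular (3 * k - 1) = 6 * triangular (- k) + 3 * triangular (- k - 1)"
    using double_triangular[of "3 * k - 1"] double_triangular[of "- k"] double_triangular[of "- k - 1"]
    by (simp add: algebra_simps)
  then show "theta_term x 1 (3 * k - 1) = theta_term (x ^ 6) (x ^ 3) (- k)"
    by (simp add: theta_term_def power_add power_mult)
qed

lemma tendsto_theta_trisect:
  assumes "a * b = fps_X ^ d" "d > 0"
  shows "(\<lambda>m. \<Sum>k=-int (3 * m + 1)..int (3 * m + 1). theta_term a b k) \<longlonglongrightarrow> theta a b"
proof -
  have "strict_mono (\<lambda>m::nat. 3 * m + 1)" by (auto intro: strict_monoI)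
  from LIMSEQ_subseq_LIMSEQ[OF tendsto_theta[OF assms] this] show ?thesis
    by (simp only: o_def)
qed

lemma theta_phi_trisect:
  assumes d: "d > 0"
  shows "theta (- (fps_X ^ d)) (- (fps_X ^ d)) = theta (- (fps_X ^ (9 * d))) (- (fps_X ^ (9 * d)))
     - 2 * fps_X ^ d * theta (- (fps_X ^ (15 * d))) (- (fps_X ^ (3 * d)))"
proof -
  define x :: "int fps" where "x = fps_X ^ d"
  have x: "x ^ n = fps_X ^ (n * d)" for n by (simp add: x_def mult.commute flip: power_mult)
  have third: "theta_term (- x) (- x) (3 * k - 1) = - x * theta_term (- (x ^ 15)) (- (x ^ 3)) (- k)" for k
    using theta_term_swap[of "- x" "- x" "3 * k - 1"] theta_term_phi_trisect(2)[of x "- k"]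
    by (simp add: algebra_simps)
  have eq: "(\<lambda>m. \<Sum>k=-int (3 * m + 1)..int (3 * m + 1). theta_term (- x) (- x) k)
    = (\<lambda>m. (\<Sum>k=-int m..int m. theta_term (- (x ^ 9)) (- (x ^ 9)) k)
      - 2 * x * (\<Sum>k=-int m..int m. theta_term (- (x ^ 15)) (- (x ^ 3)) k))"
  proof
    fix m
    have "(\<Sum>k=-int m..int m. theta_term (- x) (- x) (3 * k - 1))
      = - x * (\<Sum>k=-int m..int m. theta_term (- (x ^ 15)) (- (x ^ 3)) k)"
      unfolding third sum_distrib_left[symmetric]
      using sum_symmetric_uminus[of "theta_term (- (x ^ 15)) (- (x ^ 3))" m] by simp
    moreover have "(\<Sum>k=-int m..int m. theta_term (- x) (- x) (3 * k + 1))
      = - x * (\<Sum>k=-int m..int m. theta_term (- (x ^ 15)) (- (x ^ 3)) k)"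
      unfolding theta_term_phi_trisect sum_distrib_left[symmetric] ..
    ultimately show "(\<Sum>k=-int (3 * m + 1)..int (3 * m + 1). theta_term (- x) (- x) k)
      = (\<Sum>k=-int m..int m. theta_term (- (x ^ 9)) (- (x ^ 9)) k)
      - 2 * x * (\<Sum>k=-int m..int m. theta_term (- (x ^ 15)) (- (x ^ 3)) k)"
      unfolding sum_symmetric_trisect theta_term_phi_trisect(1) by simp
  qed
  have rhs: "(\<lambda>m. (\<Sum>k=-int m..int m. theta_term (- (x ^ 9)) (- (x ^ 9)) k)
      - 2 * x * (\<Sum>k=-int m..int m. theta_term (- (x ^ 15)) (- (x ^ 3)) k))
     \<longlonglongrightarrow> theta (- (x ^ 9)) (- (x ^ 9)) - 2 * x * theta (- (x ^ 15)) (- (x ^ 3))"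
    using d unfolding diff_conv_add_uminus mult_minus_left[symmetric]
    by (intro tendsto_add tendsto_mult tendsto_const tendsto_theta[where d = "18 * d"])
       (auto simp: x simp flip: power_add)
  have lhs: "(\<lambda>m. \<Sum>k=-int (3 * m + 1)..int (3 * m + 1). theta_term (- x) (- x) k) \<longlonglongrightarrow> theta (- x) (- x)"
    by (rule tendsto_theta_trisect[where d = "2 * d"]) (use d in \<open>simp_all add: x_def mult_2 power_add\<close>)
  have "theta (- x) (- x) = theta (- (x ^ 9)) (- (x ^ 9)) - 2 * x * theta (- (x ^ 15)) (- (x ^ 3))"
    using lhs rhs unfolding eq by (rule LIMSEQ_unique)
  then show ?thesis unfolding x by (simp only: x_def)
qed

lemma theta_psi_trisect:
  assumes d: "d > 0"
  shows "theta (fps_X ^ d) 1 = 2 * theta (fps_X ^ (6 * d)) (fps_X ^ (3 * d)) + fps_X ^ d * theta (fps_X ^ (9 * d)) 1"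
proof -
  define x :: "int fps" where "x = fps_X ^ d"
  have x: "x ^ n = fps_X ^ (n * d)" for n by (simp add: x_def mult.commute flip: power_mult)
  have eq: "(\<lambda>m. \<Sum>k=-int (3 * m + 1)..int (3 * m + 1). theta_term x 1 k)
    = (\<lambda>m. 2 * (\<Sum>k=-int m..int m. theta_term (x ^ 6) (x ^ 3) k)
      + x * (\<Sum>k=-int m..int m. theta_term (x ^ 9) 1 k))"
    unfolding sum_symmetric_trisect theta_term_psi_trisect sum_distrib_left[symmetric]
      sum_symmetric_uminus[of "theta_term (x ^ 6) (x ^ 3)"]
    by (simp add: algebra_simps)
  have rhs: "(\<lambda>m. 2 * (\<Sum>k=-int m..int m. theta_term (x ^ 6) (x ^ 3) k)
      + x * (\<Sum>k=-int m..int m. theta_term (x ^ 9) 1 k))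
     \<longlonglongrightarrow> 2 * theta (x ^ 6) (x ^ 3) + x * theta (x ^ 9) 1"
    using d by (intro tendsto_add tendsto_mult tendsto_const tendsto_theta[where d = "9 * d"])
       (auto simp: x simp flip: power_add)
  have lhs: "(\<lambda>m. \<Sum>k=-int (3 * m + 1)..int (3 * m + 1). theta_term x 1 k) \<longlonglongrightarrow> theta x 1"
    by (rule tendsto_theta_trisect[where d = d]) (use d in \<open>simp_all add: x_def\<close>)
  have "theta x 1 = 2 * theta (x ^ 6) (x ^ 3) + x * theta (x ^ 9) 1"
    using lhs rhs unfolding eq by (rule LIMSEQ_unique)
  then show ?thesis unfolding x by (simp only: x_def)
qed


section \<open>Series supported on multiples of an integer\<close>

definition supported_on_multiples :: "nat \<Rightarrow> 'a :: zero fps \<Rightarrow> bool" where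
  "supported_on_multiples d f \<longleftrightarrow> (\<forall>n. \<not> d dvd n \<longrightarrow> fps_nth f n = 0)"

named_theorems supported_intros

lemma supported_mono: "supported_on_multiples e f \<Longrightarrow> d dvd e \<Longrightarrow> supported_on_multiples d f"
  unfolding supported_on_multiples_def using dvd_trans by blast

context
  fixes d :: nat and f g :: "'a :: comm_ring_1 fps"
begin

lemma supported_1 [supported_intros]: "supported_on_multiples d (1 :: 'a fps)"
  by (auto simp: supported_on_multiples_def)

lemma supported_numeral [supported_intros]: "supported_on_multiples d (numeral w :: 'a fps)"
  by (auto simp: supported_on_multiples_def fps_numeral_nth)

lemma supported_X_power [supported_intros]: "d dvd n \<Longrightarrow> supported_on_multiples d (fps_X ^ n :: 'a fps)"
  by (auto simp: supported_on_multiples_def fps_X_power_nth)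

lemma supported_add [supported_intros]:
  "supported_on_multiples d f \<Longrightarrow> supported_on_multiples d g \<Longrightarrow> supported_on_multiples d (f + g)"
  by (simp add: supported_on_multiples_def)

lemma supported_diff [supported_intros]:
  "supported_on_multiples d f \<Longrightarrow> supported_on_multiples d g \<Longrightarrow> supported_on_multiples d (f - g)"
  by (simp add: supported_on_multiples_def)

lemma supported_uminus [supported_intros]:
  "supported_on_multiples d f \<Longrightarrow> supported_on_multiples d (- f)"
  by (simp add: supported_on_multiples_def)

lemma supported_mult [supported_intros]:
  assumes "supported_on_multiples d f" "supported_on_multiples d g"
  shows "supported_on_multiples d (f * g)"
  unfolding supported_on_multiples_def
proof (intro allI impI)
  fix n assume n: "\<not> d dvd n"
  have "fps_nth f i * fps_nth g (n - i) = 0" if "i \<le> n" for i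
  proof (cases "d dvd i")
    case True
    then have "\<not> d dvd n - i" using n that by (metis dvd_add le_add_diff_inverse)
    then show ?thesis using assms(2) by (simp add: supported_on_multiples_def)
  next
    case False
    then show ?thesis using assms(1) by (simp add: supported_on_multiples_def)
  qed
  then show "fps_nth (f * g) n = 0" by (simp add: fps_mult_nth)
qed

end

lemma supported_power [supported_intros]:
  "supported_on_multiples d f \<Longrightarrow> supported_on_multiples d (f ^ n :: 'a :: comm_ring_1 fps)"
  by (induction n) (auto intro: supported_intros)

lemma supported_sum [supported_intros]:
  "(\<And>i. i \<in> A \<Longrightarrow> supported_on_multiples d (f i)) \<Longrightarrow> supported_on_multiples d (sum f A :: 'a :: comm_ring_1 fps)"
  by (simp add: supported_on_multiples_def fps_sum_nth)

lemma supported_prod [supported_intros]: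
  fixes f :: "'b \<Rightarrow> 'a :: comm_ring_1 fps"
  assumes "\<And>i. i \<in> A \<Longrightarrow> supported_on_multiples d (f i)"
  shows "supported_on_multiples d (prod f A)"
  using assms by (induction A rule: infinite_finite_induct) (auto intro: supported_intros)

lemma supported_lim:
  fixes f :: "nat \<Rightarrow> 'a :: comm_ring_1 fps"
  assumes "f \<longlonglongrightarrow> L" "\<And>m. supported_on_multiples d (f m)"
  shows "supported_on_multiples d L"
  unfolding supported_on_multiples_def
proof (intro allI impI)
  fix n assume "\<not> d dvd n"
  then have "fps_nth (f m) n = 0" for m
    using assms(2) by (simp add: supported_on_multiples_def)
  moreover have "\<forall>\<^sub>F m in sequentially. fps_nth (f m) n = fps_nth L n"
    using assms(1) by (simp add: tendsto_fps_iff)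
  ultimately show "fps_nth L n = 0" by simp
qed

text \<open>
  The recursion for the coefficients of the inverse at an index off the multiples of \<open>d\<close> only
  involves earlier coefficients off the multiples of \<open>d\<close>.
\<close>

lemma supported_inverse:
  fixes f g :: "'a :: comm_ring_1 fps"
  assumes fg: "f * g = 1" and "fps_nth f 0 = 1" "supported_on_multiples d f"
  shows "supported_on_multiples d g"
  unfolding supported_on_multiples_def
proof (intro allI impI)
  fix n assume "\<not> d dvd n"
  then show "fps_nth g n = 0"
  proof (induction n rule: less_induct)
    case (less n)
    then have "n > 0" by (cases n) auto
    have "fps_nth f i * fps_nth g (n - i) = 0" if "i \<in> {0<..n}" for i
    proof (cases "d dvd i")
      case True
      then have "\<not> d dvd n - i" using less that by (metis dvd_add greaterThanAtMost_iff le_add_diff_inverse)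
      then show ?thesis using less.IH[of "n - i"] that by auto
    next
      case False
      then show ?thesis using assms(3) by (simp add: supported_on_multiples_def)
    qed
    then have "(\<Sum>i\<in>{0<..n}. fps_nth f i * fps_nth g (n - i)) = 0" by simp
    moreover have "fps_nth (f * g) n = fps_nth f 0 * fps_nth g n + (\<Sum>i\<in>{0<..n}. fps_nth f i * fps_nth g (n - i))"
      by (simp add: fps_mult_nth sum.head)
    ultimately show ?case using fg \<open>n > 0\<close> assms(2) by simp
  qed
qed

lemma supported_qprod [supported_intros]:
  assumes "e > 0" "d dvd e"
  shows "supported_on_multiples d (qprod e)"
  using tendsto_q_pochhammer[OF assms(1)]
  by (rule supported_lim)
     (unfold q_pochhammer_def power_mult[symmetric], intro supported_intros dvd_mult2 assms)

lemma supported_theta: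
  assumes "a * b = fps_X ^ e" "e > 0" "supported_on_multiples d a" "supported_on_multiples d b"
  shows "supported_on_multiples d (theta a b)"
  using tendsto_theta[OF assms(1,2)]
  by (rule supported_lim) (unfold theta_term_def, intro supported_intros assms)

lemma supported_nth_eq_0:
  fixes f :: "'a :: comm_ring_1 fps"
  assumes "supported_on_multiples d f" "\<not> d dvd n - r"
  shows "fps_nth (fps_X ^ r * f) n = 0"
  using assms by (simp add: supported_on_multiples_def fps_X_power_mult_nth)

section \<open>The 3-dissection of a pair of products\<close>

text \<open>
  Gauss's product for the series \<open>\<psi>\<close>. Taking it as the definition, rather than half of the bilateral
  theta series, provides a genuine integer series whose double is that theta series.
\<close>

definition psi :: "nat \<Rightarrow> int fps" where
  "psi d = qprod (2 * d) ^ 2 * fps_right_inverse (qprod d) 1"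

lemma psi_mult_qprod:
  assumes "d > 0"
  shows "psi d * qprod d = qprod (2 * d) ^ 2"
  using fps_right_inverse[of "qprod d" 1] has_prod_qprod(2)[OF assms]
  by (simp add: psi_def mult_ac)

lemma theta_psi:
  assumes "d > 0"
  shows "theta (fps_X ^ d) 1 = 2 * psi d"
proof -
  have "theta (fps_X ^ d) 1 * qprod d = (2 * psi d) * qprod d"
    using theta_psi_eq[OF assms] psi_mult_qprod[OF assms] by (simp add: mult_ac)
  then show ?thesis using qprod_nonzero[OF assms] by (metis mult_right_cancel)
qed

lemma supported_psi [supported_intros]:
  assumes "e > 0" "d dvd e"
  shows "supported_on_multiples d (psi e)"
  unfolding psi_def
proof (intro supported_intros)
  show "supported_on_multiples d (fps_right_inverse (qprod e) 1)"
    using has_prod_qprod(2)[OF assms(1)]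
    by (intro supported_inverse[OF fps_right_inverse] supported_intros assms) auto
qed (use assms in auto)

lemma psi_trisect:
  assumes d: "d > 0"
  shows "psi d = theta (fps_X ^ (6 * d)) (fps_X ^ (3 * d)) + fps_X ^ d * psi (9 * d)"
proof -
  have "2 * psi d = 2 * (theta (fps_X ^ (6 * d)) (fps_X ^ (3 * d)) + fps_X ^ d * psi (9 * d))"
    using theta_psi_trisect[OF d] theta_psi[OF d] theta_psi[of "9 * d"] d
    by (simp add: algebra_simps)
  then show ?thesis by (simp only: mult_cancel_left) simp
qed

lemma theta_phi_mult_psi:
  assumes d: "d > 0"
  shows "theta (- (fps_X ^ d)) (- (fps_X ^ d)) * psi d = qprod d * qprod (2 * d)"
proof -
  let ?phi = "theta (- (fps_X ^ d)) (- (fps_X ^ d))"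
  have "(?phi * psi d) * (qprod d * qprod (2 * d)) = (?phi * qprod (2 * d)) * (psi d * qprod d)"
    by (simp only: mult_ac)
  also have "\<dots> = (qprod d * qprod (2 * d)) * (qprod d * qprod (2 * d))"
    unfolding theta_phi_eq[OF d] psi_mult_qprod[OF d] by (simp only: power2_eq_square mult_ac)
  finally show ?thesis using d qprod_nonzero by simp
qed

text \<open>
  The left-hand side of the dissection is \<open>\<phi>(-q) \<psi>(q)\<close>, so it splits by multiplying the splittings of
  the two factors. The components \<open>A\<close> and \<open>C\<close> are \<open>\<phi>\<close> and \<open>\<psi>\<close> at \<open>9 d\<close> times \<open>f(q\<^sup>2, q)\<close> and \<open>\<Omega>\<close> at \<open>3 d\<close>; the two
  products \<open>\<phi> \<psi>\<close> and \<open>f(q\<^sup>2, q) \<Omega>\<close> agree, so the three components are in geometric progression up to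
  the coefficients 1, -1, -2.
\<close>

lemma qprod_pair_trisect:
  assumes d: "d > 0"
  obtains A C where
    "supported_on_multiples (3 * d) A" "supported_on_multiples (3 * d) C"
    "A * C = (qprod (9 * d) * qprod (18 * d)) ^ 2"
    "qprod d * qprod (2 * d) = A - fps_X ^ d * (qprod (9 * d) * qprod (18 * d)) - 2 * fps_X ^ (2 * d) * C"
proof -
  define phi9 where "phi9 = theta (- (fps_X ^ (9 * d))) (- (fps_X ^ (9 * d)))"
  define W where "W = theta (- (fps_X ^ (15 * d))) (- (fps_X ^ (3 * d)))"
  define P where "P = theta (fps_X ^ (6 * d)) (fps_X ^ (3 * d))"
  define B where "B = qprod (9 * d) * qprod (18 * d)"
  have B1: "phi9 * psi (9 * d) = B"
    using theta_phi_mult_psi[of "9 * d"] d by (simp add: phi9_def B_def)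
  have B2: "P * W = B"
    using theta_q2_q_mult_theta_Omega[of "3 * d"] d by (simp add: P_def W_def B_def)
  show thesis
  proof (rule that[of "phi9 * P" "W * psi (9 * d)"])
    show "supported_on_multiples (3 * d) (phi9 * P)"
      unfolding phi9_def P_def using d
      by (intro supported_mult supported_theta[where e = "18 * d"] supported_theta[where e = "9 * d"] supported_intros)
        (auto simp flip: power_add)
    show "supported_on_multiples (3 * d) (W * psi (9 * d))"
      unfolding W_def using d
      by (intro supported_mult supported_theta[where e = "18 * d"] supported_intros)
        (auto simp flip: power_add)
    have "phi9 * P * (W * psi (9 * d)) = (phi9 * psi (9 * d)) * (P * W)"
      by (simp only: mult_ac)
    then show "phi9 * P * (W * psi (9 * d)) = (qprod (9 * d) * qprod (18 * d)) ^ 2"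
      unfolding B1 B2 by (simp only: B_def power2_eq_square)
    have "qprod d * qprod (2 * d) = (phi9 - 2 * fps_X ^ d * W) * (P + fps_X ^ d * psi (9 * d))"
      using theta_phi_mult_psi[OF d] theta_phi_trisect[OF d] psi_trisect[OF d]
      by (simp only: phi9_def W_def P_def)
    also have "\<dots> = phi9 * P + fps_X ^ d * (phi9 * psi (9 * d)) - 2 * fps_X ^ d * (P * W)
        - 2 * (fps_X ^ d * fps_X ^ d) * (W * psi (9 * d))"
      by (simp add: algebra_simps)
    also have "\<dots> = phi9 * P - fps_X ^ d * B - 2 * fps_X ^ (2 * d) * (W * psi (9 * d))"
      unfolding B1 B2 by (simp add: power_add[symmetric] mult_2[symmetric])
    finally show "qprod d * qprod (2 * d) = phi9 * P - fps_X ^ d * (qprod (9 * d) * qprod (18 * d))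
       - 2 * fps_X ^ (2 * d) * (W * psi (9 * d))"
      unfolding B_def .
  qed
qed

section \<open>Cubes modulo 3\<close>

lemma fps_numeral_dvd_iff:
  fixes f :: "int fps"
  shows "numeral w dvd f \<longleftrightarrow> (\<forall>n. numeral w dvd fps_nth f n)"
proof
  assume "numeral w dvd f"
  then show "\<forall>n. numeral w dvd fps_nth f n"
    by (auto simp: dvd_def numeral_fps_const)
next
  assume *: "\<forall>n. numeral w dvd fps_nth f n"
  have "f = numeral w * Abs_fps (\<lambda>n. fps_nth f n div numeral w)"
    by (rule fps_ext) (use * in \<open>simp add: numeral_fps_const\<close>)
  then show "numeral w dvd f" by (rule dvdI)
qed

lemma three_dvd_q_pochhammer_cube:
  fixes q :: "'a :: comm_ring_1"
  shows "3 dvd q_pochhammer q m ^ 3 - q_pochhammer (q ^ 3) m"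
proof (induction m)
  case (Suc m)
  have "(q ^ 3) ^ Suc m = (q ^ Suc m) ^ 3" by (simp only: power_mult[symmetric] mult.commute)
  moreover have "(1 - x) ^ 3 - (1 - x ^ 3) = 3 * (x ^ 2 - x)" for x :: 'a
    by (simp add: power2_eq_square power3_eq_cube algebra_simps)
  ultimately have "3 dvd (1 - q ^ Suc m) ^ 3 - (1 - (q ^ 3) ^ Suc m)" by (metis dvd_triv_left)
  moreover have "(a * b) ^ 3 - c * e = b ^ 3 * (a ^ 3 - c) + c * (b ^ 3 - e)" for a b c e :: 'a
    by (simp add: power_mult_distrib algebra_simps)
  ultimately show ?case
    unfolding q_pochhammer_Suc using Suc by (simp only: dvd_add dvd_mult)
qed simp

lemma three_dvd_qprod_cube:
  assumes d: "d > 0"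
  shows "3 dvd qprod d ^ 3 - qprod (3 * d)"
proof -
  let ?q = "fps_X ^ d :: int fps"
  have q3: "?q ^ 3 = fps_X ^ (3 * d)" by (simp add: mult.commute flip: power_mult)
  have "(\<lambda>m. q_pochhammer ?q m * q_pochhammer ?q m * q_pochhammer ?q m + (- 1) * q_pochhammer (?q ^ 3) m)
     \<longlonglongrightarrow> qprod d * qprod d * qprod d + (- 1) * qprod (3 * d)"
    unfolding q3 using d by (intro tendsto_add tendsto_mult tendsto_const tendsto_q_pochhammer) auto
  then have lim: "(\<lambda>m. q_pochhammer ?q m ^ 3 - q_pochhammer (?q ^ 3) m) \<longlonglongrightarrow> qprod d ^ 3 - qprod (3 * d)"
    by (simp add: power3_eq_cube)
  show ?thesis
    unfolding fps_numeral_dvd_iff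
  proof
    fix n
    have "\<forall>\<^sub>F m in sequentially. fps_nth (q_pochhammer ?q m ^ 3 - q_pochhammer (?q ^ 3) m) n = fps_nth (qprod d ^ 3 - qprod (3 * d)) n"
      using lim unfolding tendsto_fps_iff by blast
    then obtain m where "fps_nth (q_pochhammer ?q m ^ 3 - q_pochhammer (?q ^ 3) m) n = fps_nth (qprod d ^ 3 - qprod (3 * d)) n"
      unfolding eventually_sequentially by blast
    with three_dvd_q_pochhammer_cube[of ?q m] show "3 dvd fps_nth (qprod d ^ 3 - qprod (3 * d)) n"
      unfolding fps_numeral_dvd_iff by metis
  qed
qed

section \<open>The generating function modulo 9\<close>

text \<open>
  None of the exponents 1, 2 modulo 3, 3 modulo 9, 6, 15 modulo 27 is 24 modulo 27, so this
  decomposition is the congruence in disguise. Write \<open>F = x + y + z\<close> for the dissection of the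
  denominator. Then \<open>1 / F = G / D\<close> with the norm \<open>D = x\<^sup>3 + y\<^sup>3 + z\<^sup>3 - 3 x y z\<close>, and the part of \<open>G\<close> that lands on
  multiples of 3 is \<open>y\<^sup>2 - x z\<close>, which equals \<open>3 y\<^sup>2\<close> since \<open>x z = -2 y\<^sup>2\<close>. Having one factor 3 for free, the
  rest is needed only modulo 3, where \<open>D\<close> is \<open>F\<^sup>3\<close> and the quotient collapses to \<open>\<psi>\<close>.
\<close>

lemma c_gf_dissection:
  obtains U1 U2 U3 U4 U5 Z where
    "supported_on_multiples 3 U1" "supported_on_multiples 3 U2" "supported_on_multiples 9 U3"
    "supported_on_multiples 27 U4" "supported_on_multiples 27 U5"
    "c_gf = fps_X ^ 1 * U1 + fps_X ^ 2 * U2 + fps_X ^ 3 * U3 + fps_X ^ 6 * U4 + fps_X ^ 15 * U5 + 9 * Z"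
proof -
  define X :: "int fps" where "X = fps_X"
  define B where "B = qprod 9 * qprod 18"
  define B' where "B' = qprod 81 * qprod 162"
  obtain A C where AC: "supported_on_multiples 3 A" "supported_on_multiples 3 C" "A * C = B ^ 2"
    and F: "qprod 1 * qprod 2 = A - X * B - 2 * X ^ 2 * C"
    using qprod_pair_trisect[of 1] by (auto simp: B_def X_def)
  \<comment> \<open>\<open>B\<close> is again a pair of products, so the same dissection applies to it at \<open>d = 9\<close>.\<close>
  obtain A' C' where AC': "supported_on_multiples 27 A'" "supported_on_multiples 27 C'" "A' * C' = B' ^ 2"
    and F': "B = A' - X ^ 9 * B' - 2 * X ^ 18 * C'"
    using qprod_pair_trisect[of 9] by (auto simp: B_def B'_def X_def)
  \<comment> \<open>The cofactor of \<open>F = x + y + z\<close> in \<open>x\<^sup>3 + y\<^sup>3 + z\<^sup>3 - 3 x y z\<close>, sorted by exponents modulo 3.\<close>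
  define G where "G = (A ^ 2 - 2 * X ^ 3 * B * C) + X * (4 * X ^ 3 * C ^ 2 + A * B) + 3 * X ^ 2 * B ^ 2"
  define D where "D = A ^ 3 - X ^ 3 * B ^ 3 - 8 * X ^ 6 * C ^ 3 - 6 * X ^ 3 * (A * B * C)"
  have FG: "(qprod 1 * qprod 2) * G = D"
  proof -
    have "3 * X ^ 2 * B ^ 2 = X ^ 2 * B ^ 2 + 2 * X ^ 2 * (A * C)" by (simp add: AC)
    then show ?thesis
      unfolding F G_def D_def by algebra
  qed
  \<comment> \<open>Modulo 3 the norm \<open>x\<^sup>3 + y\<^sup>3 + z\<^sup>3 - 3 x y z\<close> is \<open>(x + y + z)\<^sup>3\<close>, and the cube of \<open>f\<^sub>k\<close> is \<open>f\<^sub>3\<^sub>k\<close>.\<close>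
  have D_cong: "3 dvd D - qprod 3 * qprod 6"
  proof -
    have "(qprod 1 * qprod 2) ^ 3 - D
       = 3 * (- (A ^ 2 * X * B) - 2 * A ^ 2 * X ^ 2 * C + A * X ^ 2 * B ^ 2 + 4 * A * X ^ 4 * C ^ 2 
         - 2 * X ^ 4 * B ^ 2 * C - 4 * X ^ 5 * B * C ^ 2 + 6 * X ^ 3 * A * B * C)"
      unfolding F D_def by algebra
    then have 1: "3 dvd (qprod 1 * qprod 2) ^ 3 - D" by (rule dvdI)
    have "(qprod 1 * qprod 2) ^ 3 - qprod 3 * qprod 6
      = qprod 2 ^ 3 * (qprod 1 ^ 3 - qprod 3) + qprod 3 * (qprod 2 ^ 3 - qprod 6)"
      by (simp add: power_mult_distrib algebra_simps)
    then have 2: "3 dvd (qprod 1 * qprod 2) ^ 3 - qprod 3 * qprod 6"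
      using three_dvd_qprod_cube[of 1] three_dvd_qprod_cube[of 2] by simp
    from dvd_diff[OF 2 1] show ?thesis by simp
  qed
  then obtain K where K: "D = qprod 3 * qprod 6 + 3 * K"
    by (metis add_diff_cancel_left' diff_add_cancel dvd_def add.commute)
  have "fps_nth (qprod 1 * qprod 2) 0 = 1" by (simp add: has_prod_qprod(2))
  then have "fps_nth A 0 = 1" unfolding F X_def by simp
  then have D0: "fps_nth D 0 = 1" unfolding D_def X_def by (simp add: power3_eq_cube[of A])
  define V where "V = fps_right_inverse D 1"
  have DV: "D * V = 1" unfolding V_def by (rule fps_right_inverse) (simp add: D0)
  have suppB: "supported_on_multiples 9 B"
    unfolding B_def by (intro supported_intros) auto
  have suppD: "supported_on_multiples 3 D"
    unfolding D_def X_def using suppB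
    by (intro supported_intros AC) (auto intro: supported_mono)
  have suppV: "supported_on_multiples 3 V"
    by (rule supported_inverse[OF DV D0 suppD])
  define H where "H = qprod 6 ^ 3 * V"
  have H: "H = psi 3 - 3 * (K * psi 3 * V)"
  proof -
    have "psi 3 * qprod 3 = qprod 6 ^ 2" using psi_mult_qprod[of 3] by simp
    then have "qprod 6 ^ 3 - psi 3 * D = - 3 * (K * psi 3)"
      unfolding K by algebra
    then have "(qprod 6 ^ 3 - psi 3 * D) * V = - 3 * (K * psi 3 * V)" by simp
    moreover have "(qprod 6 ^ 3 - psi 3 * D) * V = H - psi 3"
      using DV by (simp add: H_def algebra_simps)
    ultimately show ?thesis by algebra
  qed
  define P where "P = theta (fps_X ^ 18) (fps_X ^ 9)"
  \<comment> \<open>This second appearance of \<open>\<psi>\<close> separates the exponents modulo 9.\<close>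
  have psi3: "psi 3 = P + X ^ 3 * psi 27"
    using psi_trisect[of 3] by (simp add: P_def X_def)
  \<comment> \<open>The part at \<open>X\<^sup>1\<^sup>8\<close> is \<open>B'\<^sup>2 - 4 A' C'\<close>, again a multiple of 3.\<close>
  have B_sq: "B ^ 2 = (A' ^ 2 + 4 * X ^ 27 * B' * C') + X ^ 9 * (4 * X ^ 27 * C' ^ 2 - 2 * A' * B') - 3 * X ^ 18 * B' ^ 2"
    using AC'(3) unfolding F' by algebra
  have c_gf: "c_gf = X * G * H"
  proof -
    have "c_gf = c_gf * (D * V)" by (simp add: DV)
    also have "\<dots> = (c_gf * (qprod 1 * qprod 2)) * G * V"
      unfolding FG[symmetric] by (simp only: mult_ac)
    also have "\<dots> = X * G * H"
      unfolding c_gf_eq H_def X_def by (simp only: mult_ac)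
    finally show ?thesis .
  qed
  show thesis
  proof (rule that)
    show "supported_on_multiples 3 ((A ^ 2 - 2 * X ^ 3 * B * C) * H)"
      "supported_on_multiples 3 ((4 * X ^ 3 * C ^ 2 + A * B) * H)"
      unfolding H_def X_def using suppB
      by (intro supported_intros AC suppV; auto intro: supported_mono)+
    show "supported_on_multiples 9 (3 * B ^ 2 * P)"
      unfolding P_def using suppB
      by (intro supported_intros supported_theta[where e = 27]) (auto simp flip: power_add)
    show "supported_on_multiples 27 (3 * (A' ^ 2 + 4 * X ^ 27 * B' * C') * psi 27)"
      "supported_on_multiples 27 (3 * (4 * X ^ 27 * C' ^ 2 - 2 * A' * B') * psi 27)"
      unfolding B'_def X_def by (intro supported_intros AC'; auto)+
    have "c_gf = X * ((A ^ 2 - 2 * X ^ 3 * B * C) * H) + X ^ 2 * ((4 * X ^ 3 * C ^ 2 + A * B) * H)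
       + 3 * X ^ 3 * B ^ 2 * H"
      unfolding c_gf G_def by algebra
    also have "3 * X ^ 3 * B ^ 2 * H = X ^ 3 * (3 * B ^ 2 * P) + 3 * X ^ 6 * B ^ 2 * psi 27
       - 9 * (X ^ 3 * B ^ 2 * (K * psi 3 * V))"
      unfolding H using psi3 by algebra
    also have "3 * X ^ 6 * B ^ 2 * psi 27 = X ^ 6 * (3 * (A' ^ 2 + 4 * X ^ 27 * B' * C') * psi 27)
      + X ^ 15 * (3 * (4 * X ^ 27 * C' ^ 2 - 2 * A' * B') * psi 27) - 9 * (X ^ 24 * B' ^ 2 * psi 27)"
      using B_sq by algebra
    finally show "c_gf = fps_X ^ 1 * ((A ^ 2 - 2 * X ^ 3 * B * C) * H) + fps_X ^ 2 * ((4 * X ^ 3 * C ^ 2 + A * B) * H)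
      + fps_X ^ 3 * (3 * B ^ 2 * P) + fps_X ^ 6 * (3 * (A' ^ 2 + 4 * X ^ 27 * B' * C') * psi 27)
      + fps_X ^ 15 * (3 * (4 * X ^ 27 * C' ^ 2 - 2 * A' * B') * psi 27)
      + 9 * (- (X ^ 24 * B' ^ 2 * psi 27) - X ^ 3 * B ^ 2 * (K * psi 3 * V))"
      unfolding X_def[symmetric] by (simp add: algebra_simps)
  qed
qed

theorem theorem4p1:
  fixes n :: nat
  shows "[c (27 * n + 24) = 0] (mod 9)"
proof -
  define N where "N = 27 * n + 24"
  obtain U1 U2 U3 U4 U5 Z where supp:
    "supported_on_multiples 3 U1" "supported_on_multiples 3 U2" "supported_on_multiples 9 U3"
    "supported_on_multiples 27 U4" "supported_on_multiples 27 U5"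
    and gf: "c_gf = fps_X ^ 1 * U1 + fps_X ^ 2 * U2 + fps_X ^ 3 * U3 + fps_X ^ 6 * U4 + fps_X ^ 15 * U5 + 9 * Z"
    by (rule c_gf_dissection)
  have "\<not> 3 dvd N - 1" "\<not> 3 dvd N - 2" "\<not> 9 dvd N - 3" "\<not> 27 dvd N - 6" "\<not> 27 dvd N - 15"
    unfolding N_def by presburger+
  with supp have "fps_nth (fps_X ^ 1 * U1) N = 0" "fps_nth (fps_X ^ 2 * U2) N = 0"
    "fps_nth (fps_X ^ 3 * U3) N = 0" "fps_nth (fps_X ^ 6 * U4) N = 0" "fps_nth (fps_X ^ 15 * U5) N = 0"
    by (blast intro: supported_nth_eq_0)+
  then have "c N = fps_nth (9 * Z) N"
    unfolding c_def gf by (simp only: fps_add_nth add_0_left)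
  moreover have "9 dvd fps_nth (9 * Z) N"
    using fps_numeral_dvd_iff dvd_triv_left by blast
  ultimately show ?thesis
    unfolding N_def[symmetric] by (simp add: cong_0_iff)
qed

end
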